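(* Let $1 \le d \le D$ be integers and let $\mathbf{A} \in \mathcal{A}$, i.e. $\mathbf{A} \in \mathbb{R}^{D\times d}$ is such that every $d \times d$ submatrix extracted from $\mathbf{A}$ by selecting $d$ rows is invertible. Then $\mathcal{U}$ is the smallest closed set $\mathcal{Y} \subseteq \mathbb{R}^d$ such that $p_{\mathcal{X}}(\mathbf{A}\mathcal{Y}) = \mathcal{E}$. Furthermore, $\mathcal{U}$ is compact and is star-shaped with respect to every point of $\mathcal{I}$.
   Context: $\mathcal{X} = [-1,1]^D \subset \mathbb{R}^D$, and $p_{\mathcal{X}} : \mathbb{R}^D \to \mathcal{X}$ denotes the convex projection onto $\mathcal{X}$ (Euclidean nearest-point map). For $\mathbf{A} \in \mathbb{R}^{D \times d}$ define $\phi : \mathbb{R}^d \to \mathcal{X}$, $\phi(\mathbf{y}) = p_{\mathcal{X}}(\mathbf{A}\mathbf{y})$, and $\mathcal{E} = \phi(\mathbb{R}^d) = p_{\mathcal{X}}(\mathbf{A}\mathbb{R}^d)$. For $\mathcal{Y}\subseteq\mathbb{R}^d$, $p_{\mathcal{X}}(\mathbf{A}\mathcal{Y}) = \{p_{\mathcal{X}}(\mathbf{A}\mathbf{y}) : \mathbf{y} \in \mathcal{Y}\}$. $\mathbf{A}_i$ denotes the $i$-th row of $\mathbf{A}$. The strips are $\mathcal{S}_i = \{\mathbf{y} \in \mathbb{R}^d : -1 \le \mathbf{A}_i \mathbf{y} \le 1\}$, $i = 1,\dots,D$. Their intersection is $\mathcal{I} = \bigcap_{i=1}^D \mathcal{S}_i$.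 For $I \subseteq \{1,\dots,D\}$ with $|I| = d$, the parallelotope $\mathcal{P}_I$ is $\mathcal{P}_I = \bigcap_{i \in I} \mathcal{S}_i$, and $\mathcal{U} = \bigcup_{I \subseteq \{1,\dots,D\},\, |I| = d} \mathcal{P}_I$. "Smallest closed set with a property" means: the set is closed, has the property, and is contained in every closed set having the property. A set $S$ is star-shaped with respect to a point $\mathbf{p} \in S$ if for every $\mathbf{s} \in S$ the segment $[\mathbf{p},\mathbf{s}]$ is contained in $S$. *)

theory Defs
  imports "HOL-Analysis.Analysis"
begin

(* R^d and R^D are real^'d and real^'m, with d = CARD('d) and D = CARD('m).
   A D x d matrix then has type real^'d^'m. *)

definition cube :: "(real ^ 'm) set" where
  "cube = {x. \<forall>i. -1 \<le> x $ i \<and> x $ i \<le> 1}"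

definition cube_map :: "real ^ 'd ^ 'm \<Rightarrow> real ^ 'd \<Rightarrow> real ^ 'm" where
  "cube_map A y = closest_point cube (A *v y)"

(* Selecting d rows is an injective choice f of row indices; distinct f with the
   same range give the same submatrix up to the order of its rows. *)
definition row_submatrix :: "real ^ 'd ^ 'm \<Rightarrow> ('d \<Rightarrow> 'm) \<Rightarrow> real ^ 'd ^ 'd" where
  "row_submatrix A f = (\<chi> k. row (f k) A)"

definition all_square_submatrices_invertible :: "real ^ 'd ^ 'm \<Rightarrow> bool" where
  "all_square_submatrices_invertible A \<longleftrightarrow>
     (\<forall>f :: 'd \<Rightarrow> 'm. inj f \<longrightarrow> invertible (row_submatrix A f))"

definition strip :: "real ^ 'd ^ 'm \<Rightarrow> 'm \<Rightarrow> (real ^ 'd) set" where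
  "strip A i = {y. -1 \<le> row i A \<bullet> y \<and> row i A \<bullet> y \<le> 1}"

definition strip_inter :: "real ^ 'd ^ 'm \<Rightarrow> (real ^ 'd) set" where
  "strip_inter A = (\<Inter>i. strip A i)"

definition parallelotope :: "real ^ 'd ^ 'm \<Rightarrow> 'm set \<Rightarrow> (real ^ 'd) set" where
  "parallelotope A I = (\<Inter>i\<in>I. strip A i)"

definition parallelotope_union :: "real ^ 'd ^ 'm \<Rightarrow> (real ^ 'd) set" where
  "parallelotope_union A = (\<Union>I\<in>{I :: 'm set. card I = CARD('d)}. parallelotope A I)"

definition smallest_closed :: "('a::topological_space set \<Rightarrow> bool) \<Rightarrow> 'a set \<Rightarrow> bool" where
  "smallest_closed P S \<longleftrightarrow> closed S \<and> P S \<and> (\<forall>T. closed T \<and> P T \<longrightarrow> S \<subseteq> T)"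

(* The library's starlike only asserts that some centre exists. *)
definition star_shaped_wrt :: "'a::real_vector set \<Rightarrow> 'a \<Rightarrow> bool" where
  "star_shaped_wrt S p \<longleftrightarrow> p \<in> S \<and> (\<forall>s\<in>S. closed_segment p s \<subseteq> S)"

end

theory Submission
  imports Defs
begin

text \<open>
  The projection onto the cube clips every coordinate to \<open>[-1, 1]\<close>. Hence two points have the same
  image under \<^const>\<open>cube_map\<close> exactly if, row by row, their values either agree or are both
  \<open>\<ge> 1\<close> or both \<open>\<le> -1\<close>. A point lies in \<open>\<U>\<close> exactly if it lies in at least \<open>d\<close> strips,
  and by hypothesis the values of any \<open>d\<close> rows determine a point.

  \<^item> \<open>\<U>\<close> covers the whole image (\<open>cube_map_image_parallelotope_union\<close>): the fibre of
    \<^const>\<open>cube_map\<close> through a point is a polyhedron without lines, so it has a vertex, at least \<open>d\<close>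
    constraints are tight there, and each of these puts the vertex into a strip. The vertex is found by taking a point of
    the fibre that lies in as many strips as possible: if these are fewer than \<open>d\<close>, some line through
    the point keeps all their row values fixed, and following it until the next strip is reached stays
    in the fibre (\<open>enter_further_strip\<close>).

  \<^item> No closed set with the same image misses a point of \<open>\<U>\<close>
    (\<open>parallelotope_union_subset_closed\<close>): at a point in the interior of a parallelotope, \<open>d\<close> row
    values are unclipped, so the fibre is a single point, and these interiors are dense in \<open>\<U>\<close>.

  \<^item> Each parallelotope is the image of a cube under an invertible linear map, hence compact, and it is
    convex and contains \<open>\<I>\<close>. The claims on compactness and star-shapedness follow by taking the
    finite union.
\<close>

section \<open>Projection onto the cube\<close>

lemma cube_eq_cbox: "cube = cbox (- 1) (1 :: real ^ 'm)"
  by (auto simp: cube_def mem_box_cart)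

lemma closest_point_cube:
  fixes x :: "real ^ 'm"
  shows "closest_point cube x = (\<chi> i. max (- 1) (min 1 (x $ i)))" (is "_ = ?c")
proof -
  have "?c = closest_point cube x"
  proof (rule closest_point_unique)
    show "convex (cube :: (real ^ 'm) set)" "closed (cube :: (real ^ 'm) set)"
      by (simp_all add: cube_eq_cbox closed_cbox)
    show "?c \<in> cube"
      by (simp add: cube_def)
    show "\<forall>z\<in>cube. dist x ?c \<le> dist x z"
    proof
      fix z :: "real ^ 'm"
      assume z: "z \<in> cube"
      show "dist x ?c \<le> dist x z"
        unfolding dist_norm
      proof (rule norm_le_componentwise_cart)
        fix i
        have "- 1 \<le> z $ i" "z $ i \<le> 1"
          using z by (auto simp: cube_def)
        then show "norm ((x - ?c) $ i) \<le> norm ((x - z) $ i)"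
          by (simp add: max_def min_def)
      qed
    qed
  qed
  then show ?thesis ..
qed

lemma cube_map_eq_iff:
  "cube_map A y = cube_map A z \<longleftrightarrow>
    (\<forall>i. max (- 1) (min 1 (row i A \<bullet> y)) = max (- 1) (min 1 (row i A \<bullet> z)))"
proof -
  have "(A *v x) $ i = row i A \<bullet> x" for x i
    by (simp add: matrix_vector_mul_component row_def vec_lambda_eta)
  then show ?thesis
    by (simp add: cube_map_def closest_point_cube vec_eq_iff)
qed

section \<open>Strips, rows and parallelotopes\<close>

lemma mem_strip_iff: "y \<in> strip A i \<longleftrightarrow> \<bar>row i A \<bullet> y\<bar> \<le> 1"
  by (auto simp: strip_def abs_le_iff)

lemma row_submatrix_component: "(row_submatrix A f *v y) $ k = row (f k) A \<bullet> y"
  by (simp add: row_submatrix_def matrix_vector_mul_component)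

lemma obtain_row_submatrix:
  fixes A :: "real ^ 'd ^ 'm"
  assumes "all_square_submatrices_invertible A" "card I = CARD('d)"
  obtains f :: "'d \<Rightarrow> 'm" where "range f = I" "invertible (row_submatrix A f)"
proof -
  obtain f :: "'d \<Rightarrow> 'm" where "bij_betw f UNIV I"
    using finite_same_card_bij[of "UNIV :: 'd set" I] assms(2) by auto
  then show thesis
    using assms(1) that by (auto simp: bij_betw_def all_square_submatrices_invertible_def)
qed

lemma rows_determine_point:
  fixes A :: "real ^ 'd ^ 'm"
  assumes "all_square_submatrices_invertible A" "card I = CARD('d)"
    and eq: "\<And>i. i \<in> I \<Longrightarrow> row i A \<bullet> y = row i A \<bullet> z"
  shows "y = z"
proof -
  obtain f :: "'d \<Rightarrow> 'm" where f: "range f = I" "invertible (row_submatrix A f)"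
    using obtain_row_submatrix assms(1,2) by blast
  have "row_submatrix A f *v y = row_submatrix A f *v z"
    using eq f(1) by (auto simp: vec_eq_iff row_submatrix_component)
  then show ?thesis
    using f(2) by (metis invertible_def matrix_vector_mul_assoc matrix_vector_mul_lid)
qed

lemma compact_parallelotope:
  fixes A :: "real ^ 'd ^ 'm"
  assumes "all_square_submatrices_invertible A" "card I = CARD('d)"
  shows "compact (parallelotope A I)"
proof -
  obtain f :: "'d \<Rightarrow> 'm" where f: "range f = I" "invertible (row_submatrix A f)"
    using obtain_row_submatrix assms by blast
  then obtain B where B: "row_submatrix A f ** B = mat 1" "B ** row_submatrix A f = mat 1"
    by (auto simp: invertible_def)
  have "y \<in> parallelotope A I \<longleftrightarrow> row_submatrix A f *v y \<in> cube" for y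
    using f(1) by (auto simp: parallelotope_def strip_def cube_def row_submatrix_component)
  moreover have "row_submatrix A f *v (B *v x) = x" "B *v (row_submatrix A f *v y) = y" for x y
    by (simp_all add: matrix_vector_mul_assoc B)
  ultimately have "parallelotope A I = (*v) B ` cube"
    by (metis (no_types, lifting) image_iff set_eqI)
  moreover have "compact ((*v) B ` cube)"
    by (intro compact_continuous_image matrix_vector_mult_linear_continuous_on)
      (simp add: cube_eq_cbox compact_cbox)
  ultimately show ?thesis
    by simp
qed

lemma convex_parallelotope: "convex (parallelotope A I)"
proof -
  have "strip A i = {y. row i A \<bullet> y \<ge> - 1} \<inter> {y. row i A \<bullet> y \<le> 1}" for i
    by (auto simp: strip_def)
  then show ?thesis
    unfolding parallelotope_def
    by (simp add: convex_INT convex_Int convex_halfspace_le convex_halfspace_ge)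
qed

lemma mem_parallelotope_union_iff:
  fixes A :: "real ^ 'd ^ 'm"
  shows "y \<in> parallelotope_union A \<longleftrightarrow> CARD('d) \<le> card {i. y \<in> strip A i}"
proof
  assume "y \<in> parallelotope_union A"
  then obtain I where "card I = CARD('d)" "I \<subseteq> {i. y \<in> strip A i}"
    by (auto simp: parallelotope_union_def parallelotope_def)
  then show "CARD('d) \<le> card {i. y \<in> strip A i}"
    by (metis card_mono finite)
next
  assume "CARD('d) \<le> card {i. y \<in> strip A i}"
  then obtain I where "I \<subseteq> {i. y \<in> strip A i}" "card I = CARD('d)"
    using obtain_subset_with_card_n by metis
  then show "y \<in> parallelotope_union A"
    by (auto simp: parallelotope_union_def parallelotope_def)
qed

section \<open>Vertices of the fibres\<close>

lemma rows_orthogonal_exists: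
  fixes A :: "real ^ 'd ^ 'm"
  assumes "card T < CARD('d)"
  obtains v where "v \<noteq> 0" "\<And>i. i \<in> T \<Longrightarrow> row i A \<bullet> v = 0"
proof -
  have "dim ((\<lambda>i. row i A) ` T) \<le> card ((\<lambda>i. row i A) ` T)"
    by (simp add: dim_le_card')
  also have "\<dots> \<le> card T"
    by (simp add: card_image_le)
  finally have "dim ((\<lambda>i. row i A) ` T) < DIM(real ^ 'd)"
    using assms by simp
  then obtain v where "v \<noteq> 0" "\<And>y. y \<in> span ((\<lambda>i. row i A) ` T) \<Longrightarrow> orthogonal v y"
    using orthogonal_to_subspace_exists by metis
  then show thesis
    using that by (metis image_eqI inner_commute orthogonal_def span_base)
qed

text \<open>
  Walking along a line that fixes the row values of the strips containing \<open>z\<close> and strictly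
  decreases some other \<open>\<bar>row j A \<bullet> z\<bar>\<close>, we stop at the first moment one of the remaining values
  reaches \<open>\<plusminus>1\<close>. Until then no value that is clipped changes its side, so the image under
  \<^const>\<open>cube_map\<close> is constant.
\<close>

lemma enter_further_strip:
  fixes A :: "real ^ 'd ^ 'm"
  assumes "CARD('d) \<le> CARD('m)" and "all_square_submatrices_invertible A"
    and few: "card {i. z \<in> strip A i} < CARD('d)"
  obtains z' where "cube_map A z' = cube_map A z"
    and "card {i. z \<in> strip A i} < card {i. z' \<in> strip A i}"
proof -
  define a where "a i = row i A \<bullet> z" for i
  define T where "T = {i. z \<in> strip A i}"
  have T_iff: "i \<in> T \<longleftrightarrow> \<bar>a i\<bar> \<le> 1" for i
    by (simp add: T_def a_def mem_strip_iff)
  obtain v0 where v0: "v0 \<noteq> 0" "\<And>i. i \<in> T \<Longrightarrow> row i A \<bullet> v0 = 0"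
    using rows_orthogonal_exists few unfolding T_def by blast
  obtain I :: "'m set" where "card I = CARD('d)"
    using obtain_subset_with_card_n[OF assms(1)] by blast
  then obtain j where j: "row j A \<bullet> v0 \<noteq> 0"
    using rows_determine_point[OF assms(2), of I v0 0] v0(1) by auto
  \<comment> \<open>Orient the line such that the value at row \<open>j\<close> moves towards \<open>0\<close>.\<close>
  define v where "v = (if a j * (row j A \<bullet> v0) < 0 then v0 else - v0)"
  define b where "b i = row i A \<bullet> v" for i
  have b_T: "b i = 0" if "i \<in> T" for i
    using v0(2)[OF that] by (simp add: b_def v_def)
  have "j \<notin> T"
    using j v0(2) by blast
  then have "a j \<noteq> 0"
    by (auto simp: T_iff)
  then have bj: "a j * b j < 0"
    using j by (auto simp: b_def v_def not_less order_less_le)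
  define J where "J = {i. a i * b i < 0}"
  define hit where "hit i = (\<bar>a i\<bar> - 1) / \<bar>b i\<bar>" for i
  define t where "t = Min (hit ` J)"
  have J: "\<bar>a i\<bar> > 1" "b i \<noteq> 0" if "i \<in> J" for i
    using that b_T[of i] T_iff[of i] by (auto simp: J_def)
  have "j \<in> J"
    using bj by (simp add: J_def)
  then have "t \<in> hit ` J"
    unfolding t_def by (intro Min_in) auto
  then obtain k where k: "k \<in> J" "t = hit k"
    by blast
  have t_le: "t \<le> hit i" if "i \<in> J" for i
    using that by (simp add: t_def)
  have t_pos: "t > 0"
    using J[OF k(1)] k(2) by (simp add: hit_def)
  have row_z': "row i A \<bullet> (z + t *\<^sub>R v) = a i + t * b i" for i
    by (simp add: a_def b_def inner_add_right)
  have slow: "t * \<bar>b i\<bar> \<le> \<bar>a i\<bar> - 1" if "i \<in> J" for i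
    using t_le[OF that] J[OF that] by (simp add: hit_def field_simps)
  have far: "(a i > 1 \<and> a i + t * b i \<ge> 1) \<or> (a i < - 1 \<and> a i + t * b i \<le> - 1)"
    if i: "i \<notin> T" for i
  proof -
    have "\<bar>a i\<bar> > 1"
      using i by (simp add: T_iff)
    then consider "a i > 1" | "a i < - 1"
      by linarith
    then show ?thesis
    proof cases
      case 1
      show ?thesis
      proof (cases "b i < 0")
        case True
        with 1 have "i \<in> J"
          by (simp add: J_def mult_pos_neg)
        with 1 True slow[of i] show ?thesis
          by simp
      next
        case False
        then have "t * b i \<ge> 0"
          using t_pos by simp
        with 1 show ?thesis
          by linarith
      qed
    next
      case 2
      show ?thesis
      proof (cases "b i > 0")
        case True
        with 2 have "i \<in> J"
          by (simp add: J_def mult_neg_pos)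
        with 2 True slow[of i] show ?thesis
          by simp
      next
        case False
        then have "t * b i \<le> 0"
          using t_pos by (simp add: mult_le_0_iff)
        with 2 show ?thesis
          by linarith
      qed
    qed
  qed
  have "max (- 1) (min 1 (a i + t * b i)) = max (- 1) (min 1 (a i))" for i
    using far[of i] b_T[of i] by (cases "i \<in> T") auto
  then have same: "cube_map A (z + t *\<^sub>R v) = cube_map A z"
    by (simp only: cube_map_eq_iff row_z' a_def[symmetric] simp_thms)
  have "t * \<bar>b k\<bar> = \<bar>a k\<bar> - 1"
    using J[OF k(1)] k(2) by (simp add: hit_def)
  then have "\<bar>a k + t * b k\<bar> \<le> 1"
    using k(1) by (auto simp: J_def mult_less_0_iff)
  then have k_in: "z + t *\<^sub>R v \<in> strip A k"
    by (simp add: mem_strip_iff row_z')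
  have T_sub: "T \<subseteq> {i. z + t *\<^sub>R v \<in> strip A i}"
    using b_T by (auto simp: mem_strip_iff row_z' T_iff)
  have "k \<notin> T"
    using J[OF k(1)] by (simp add: T_iff)
  with k_in T_sub have "T \<subset> {i. z + t *\<^sub>R v \<in> strip A i}"
    by blast
  then have "card T < card {i. z + t *\<^sub>R v \<in> strip A i}"
    by (simp add: psubset_card_mono)
  with same show thesis
    using that by (simp add: T_def)
qed

lemma cube_map_image_parallelotope_union:
  fixes A :: "real ^ 'd ^ 'm"
  assumes "CARD('d) \<le> CARD('m)" and "all_square_submatrices_invertible A"
  shows "cube_map A ` parallelotope_union A = range (cube_map A)"
proof -
  have "\<exists>u\<in>parallelotope_union A. cube_map A u = cube_map A y" for y
  proof -
    define n where "n z = card {i. z \<in> strip A i}" for z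
    have "\<exists>u. cube_map A u = cube_map A y \<and> (\<forall>z. cube_map A z = cube_map A y \<longrightarrow> n z \<le> n u)"
      by (rule ex_has_greatest_nat[where k = y and b = "Suc (CARD('m))"])
        (auto simp: n_def less_Suc_eq_le intro: card_mono)
    then obtain u where u: "cube_map A u = cube_map A y"
      "\<And>z. cube_map A z = cube_map A y \<Longrightarrow> n z \<le> n u"
      by blast
    have "\<not> n u < CARD('d)"
    proof
      assume "n u < CARD('d)"
      then obtain z where "cube_map A z = cube_map A u" "n u < n z"
        using enter_further_strip[OF assms] unfolding n_def by metis
      with u show False
        by (metis not_less)
    qed
    with u(1) show ?thesis
      by (auto simp: mem_parallelotope_union_iff n_def not_less)
  qed
  then show ?thesis
    by (auto simp: image_iff) metis
qed

section \<open>Minimality\<close>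

lemma mem_of_open_strips:
  fixes A :: "real ^ 'd ^ 'm"
  assumes "all_square_submatrices_invertible A" "card I = CARD('d)"
    and inside: "\<And>i. i \<in> I \<Longrightarrow> \<bar>row i A \<bullet> y\<bar> < 1"
    and onto: "cube_map A ` Y = range (cube_map A)"
  shows "y \<in> Y"
proof -
  have "cube_map A y \<in> cube_map A ` Y"
    by (simp add: onto)
  then obtain z where z: "z \<in> Y" "cube_map A y = cube_map A z"
    by blast
  have "row i A \<bullet> y = row i A \<bullet> z" if "i \<in> I" for i
    using z(2) inside[OF that] unfolding cube_map_eq_iff
    by (auto simp: max_def min_def split: if_splits dest!: spec[of _ i])
  then have "y = z"
    using rows_determine_point assms(1,2) by blast
  with z(1) show ?thesis
    by simp
qed

text \<open>
  Shrinking a point of a parallelotope towards the origin moves it into the interior, so the point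
  is a limit of points that the closed set contains by \<open>mem_of_open_strips\<close>.
\<close>

lemma parallelotope_union_subset_closed:
  fixes A :: "real ^ 'd ^ 'm"
  assumes "all_square_submatrices_invertible A"
    and "closed Y" and onto: "cube_map A ` Y = range (cube_map A)"
  shows "parallelotope_union A \<subseteq> Y"
proof
  fix y
  assume "y \<in> parallelotope_union A"
  then obtain I where I: "card I = CARD('d)" "\<And>i. i \<in> I \<Longrightarrow> \<bar>row i A \<bullet> y\<bar> \<le> 1"
    by (auto simp: parallelotope_union_def parallelotope_def mem_strip_iff)
  define s :: "nat \<Rightarrow> real" where "s n = 1 - inverse (real (Suc n))" for n
  have s: "0 \<le> s n" "s n < 1" for n
    by (simp_all add: s_def inverse_le_1_iff)
  have "s n *\<^sub>R y \<in> Y" for n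
  proof (rule mem_of_open_strips[OF assms(1) I(1) _ onto])
    fix i
    assume "i \<in> I"
    have "s n * \<bar>row i A \<bullet> y\<bar> \<le> s n * 1"
      using I(2)[OF \<open>i \<in> I\<close>] s(1) by (rule mult_left_mono)
    also have "\<dots> < 1"
      using s(2)[of n] by simp
    finally show "\<bar>row i A \<bullet> (s n *\<^sub>R y)\<bar> < 1"
      using s(1)[of n] by (simp add: abs_mult)
  qed
  moreover have "(\<lambda>n. s n *\<^sub>R y) \<longlonglongrightarrow> (1 - 0) *\<^sub>R y"
    unfolding s_def by (intro tendsto_intros LIMSEQ_inverse_real_of_nat)
  ultimately show "y \<in> Y"
    using closed_sequentially[OF \<open>closed Y\<close>, of "\<lambda>n. s n *\<^sub>R y" y] by simp
qed

section \<open>Compactness and star-shapedness\<close>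

lemma compact_parallelotope_union:
  assumes "all_square_submatrices_invertible A"
  shows "compact (parallelotope_union A)"
  unfolding parallelotope_union_def using compact_parallelotope[OF assms] by (intro compact_UN) auto

lemma star_shaped_parallelotope_union:
  fixes A :: "real ^ 'd ^ 'm"
  assumes "CARD('d) \<le> CARD('m)" and p: "p \<in> strip_inter A"
  shows "star_shaped_wrt (parallelotope_union A) p"
proof -
  have "p \<in> parallelotope_union A"
    using assms by (simp add: mem_parallelotope_union_iff strip_inter_def)
  moreover have "closed_segment p s \<subseteq> parallelotope_union A"
    if "s \<in> parallelotope_union A" for s
  proof -
    obtain I where I: "card I = CARD('d)" "s \<in> parallelotope A I"
      using \<open>s \<in> parallelotope_union A\<close> by (auto simp: parallelotope_union_def)
    moreover have "p \<in> parallelotope A I"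
      using p by (simp add: strip_inter_def parallelotope_def)
    ultimately have "closed_segment p s \<subseteq> parallelotope A I"
      by (simp add: closed_segment_subset convex_parallelotope)
    with I(1) show ?thesis
      by (auto simp: parallelotope_union_def)
  qed
  ultimately show ?thesis
    by (simp add: star_shaped_wrt_def)
qed

section \<open>The smallest closed set with full image\<close>

theorem theorem1:
  fixes A :: "real ^ 'd ^ 'm"
  assumes "CARD('d) \<le> CARD('m)"
    and "all_square_submatrices_invertible A"
  shows "smallest_closed (\<lambda>Y. cube_map A ` Y = range (cube_map A)) (parallelotope_union A)
    \<and> compact (parallelotope_union A)
    \<and> (\<forall>p\<in>strip_inter A. star_shaped_wrt (parallelotope_union A) p)"
  using cube_map_image_parallelotope_union[OF assms] compact_parallelotope_union[OF assms(2)]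
    parallelotope_union_subset_closed[OF assms(2)] star_shaped_parallelotope_union[OF assms(1)]
  by (auto simp: smallest_closed_def compact_imp_closed)

end
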